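(* Let $N$ and $B$ be nearrings. If $f:N\to B$ is a split epimorphism of nearrings with $\ker(f)=A$, then $N$ is a semidirect sum of $A$ and a subnearring of $N$ which is an isomorphic copy of $B$.
   Context: A nearring is a set $N$ with operations $+,\cdot$ such that $(N,+)$ is a (not necessarily abelian) group, $(N,\cdot)$ is a semigroup, and $(x+y)z=xz+yz$ for all $x,y,z\in N$ (right distributivity). It need not be zero-symmetric. An ideal $I$ of $N$ is a normal subgroup of $(N,+)$ with $in\in I$ and $n(i+m)-nm\in I$ for all $i\in I$, $n,m\in N$. A nearring homomorphism $f:N\to B$ is a split epimorphism if there is a nearring homomorphism $g:B\to N$ with $f\circ g=1_B$. A nearring $N$ is the (internal) semidirect sum of two nearrings $A$ and $B$ if $A$ is an ideal of $N$, $B$ is a subnearring of $N$, $N=A+B$, $A\cap B=0$ and $N/A\cong B$. *)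

theory Defs
  imports "HOL-Algebra.QuotRing"
begin

text \<open>
  Nearrings are carried by the record type of HOL-Algebra rings. The field \<open>one\<close> of that record
  is never constrained below: a nearring need not have a multiplicative identity, and
  homomorphisms, subnearrings and isomorphisms ignore that field.
\<close>

locale nearring =
  fixes N :: "('a, 'm) ring_scheme" (structure)
  assumes add_group: "group (add_monoid N)"
    and mult_closed: "\<lbrakk>x \<in> carrier N; y \<in> carrier N\<rbrakk> \<Longrightarrow> x \<otimes> y \<in> carrier N"
    and mult_assoc: "\<lbrakk>x \<in> carrier N; y \<in> carrier N; z \<in> carrier N\<rbrakk>
      \<Longrightarrow> (x \<otimes> y) \<otimes> z = x \<otimes> (y \<otimes> z)"
    and right_distrib: "\<lbrakk>x \<in> carrier N; y \<in> carrier N; z \<in> carrier N\<rbrakk>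
      \<Longrightarrow> (x \<oplus> y) \<otimes> z = (x \<otimes> z) \<oplus> (y \<otimes> z)"

definition nearring_ideal :: "'a set \<Rightarrow> ('a, 'm) ring_scheme \<Rightarrow> bool" where
  "nearring_ideal I N \<longleftrightarrow> normal I (add_monoid N) \<and>
     (\<forall>i\<in>I. \<forall>n\<in>carrier N. i \<otimes>\<^bsub>N\<^esub> n \<in> I) \<and>
     (\<forall>i\<in>I. \<forall>n\<in>carrier N. \<forall>m\<in>carrier N. n \<otimes>\<^bsub>N\<^esub> (i \<oplus>\<^bsub>N\<^esub> m) \<ominus>\<^bsub>N\<^esub> n \<otimes>\<^bsub>N\<^esub> m \<in> I)"

definition subnearring :: "'a set \<Rightarrow> ('a, 'm) ring_scheme \<Rightarrow> bool" where
  "subnearring S N \<longleftrightarrow> subgroup S (add_monoid N) \<and> (\<forall>x\<in>S. \<forall>y\<in>S. x \<otimes>\<^bsub>N\<^esub> y \<in> S)"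

text \<open>The first \<^const>\<open>hom\<close> is preservation of addition, the second of multiplication.\<close>

definition nearring_hom ::
  "('a, 'm) ring_scheme \<Rightarrow> ('b, 'n) ring_scheme \<Rightarrow> ('a \<Rightarrow> 'b) set" where
  "nearring_hom N B = hom (add_monoid N) (add_monoid B) \<inter> hom N B"

definition nearring_isomorphic ::
  "('a, 'm) ring_scheme \<Rightarrow> ('b, 'n) ring_scheme \<Rightarrow> bool" where
  "nearring_isomorphic N B \<longleftrightarrow> (\<exists>h \<in> nearring_hom N B. bij_betw h (carrier N) (carrier B))"

definition nearring_split_epi ::
  "('a, 'm) ring_scheme \<Rightarrow> ('b, 'n) ring_scheme \<Rightarrow> ('a \<Rightarrow> 'b) \<Rightarrow> bool" where
  "nearring_split_epi N B f \<longleftrightarrow>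
     f \<in> nearring_hom N B \<and> (\<exists>g \<in> nearring_hom B N. \<forall>b\<in>carrier B. f (g b) = b)"

text \<open>
  \<open>N Quot A\<close> is the library's coset construction; it uses no ring axioms, and for a nearring
  ideal \<open>A\<close> its operations are \<open>(A + x) + (A + y) = A + (x + y)\<close> and \<open>(A + x)(A + y) = A + xy\<close>.
\<close>

definition semidirect_sum :: "('a, 'm) ring_scheme \<Rightarrow> 'a set \<Rightarrow> 'a set \<Rightarrow> bool" where
  "semidirect_sum N A B \<longleftrightarrow> nearring N \<and> nearring_ideal A N \<and> subnearring B N \<and>
     carrier N = A <+>\<^bsub>N\<^esub> B \<and> A \<inter> B = {\<zero>\<^bsub>N\<^esub>} \<and>
     nearring_isomorphic (N Quot A) (N\<lparr>carrier := B\<rparr>)"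

end

theory Submission
  imports Defs
begin

text \<open>
  Let \<open>g\<close> be a section of \<open>f\<close> and take \<open>C = g(B)\<close>. Being injective, \<open>g\<close> is an isomorphism of \<open>B\<close>
  onto \<open>C\<close>. Every \<open>x\<close> in \<open>N\<close> splits as \<open>x = (x - g (f x)) + g (f x)\<close>, whose first summand is killed
  by \<open>f\<close>; this is \<open>N = A + C\<close>. An element \<open>g b\<close> of \<open>C\<close> that lies in \<open>A\<close> satisfies \<open>b = f (g b) = 0\<close>, so
  \<open>A \<inter> C = 0\<close>. Finally \<open>f\<close> is onto, so \<open>N/A \<cong> B \<cong> C\<close> by the first isomorphism theorem.

  The additive half of the first isomorphism theorem is the one for groups. The
  multiplicative half rests on the description of the cosets of the kernel as the fibres of \<open>f\<close>
  (\<open>kernel_coset_eq_fibre\<close>): the product of the fibres over \<open>f x\<close> and \<open>f y\<close> is then visibly the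
  fibre over \<open>f x \<cdot> f y\<close>. Right distributivity enters only through the identity \<open>0 \<cdot> n = 0\<close>,
  which gives closure of the kernel under right multiplication; the mirror identity \<open>n \<cdot> 0 = 0\<close>
  can fail in a nearring, and the other ideal condition \<open>n (i + m) - n m \<in> A\<close> is shaped so
  that it follows from \<open>f (i + m) = f m\<close> alone.
\<close>

lemma (in nearring) zero_mult:
  assumes "x \<in> carrier N" shows "\<zero> \<otimes> x = \<zero>"
proof -
  interpret add: group "add_monoid N" by (rule add_group)
  have "\<zero> \<in> carrier N" and "\<zero> \<oplus> \<zero> = \<zero>"
    using add.one_closed add.l_one[OF add.one_closed] by simp_all
  then have "\<zero> \<otimes> x \<oplus> \<zero> \<otimes> x = \<zero> \<otimes> x"
    using right_distrib assms by metis
  then show ?thesis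
    using add.l_cancel_one[of "\<zero> \<otimes> x" "\<zero> \<otimes> x"] mult_closed[OF \<open>\<zero> \<in> carrier N\<close> assms] by simp
qed

lemma nearring_isomorphic_trans:
  assumes "nearring_isomorphic L M" and "nearring_isomorphic M N"
  shows "nearring_isomorphic L N"
proof -
  obtain h k where h: "h \<in> nearring_hom L M" "bij_betw h (carrier L) (carrier M)"
    and k: "k \<in> nearring_hom M N" "bij_betw k (carrier M) (carrier N)"
    using assms unfolding nearring_isomorphic_def by blast
  have "k \<circ> h \<in> nearring_hom L N"
    using h(1) k(1) unfolding nearring_hom_def by (auto intro: hom_compose)
  moreover have "bij_betw (k \<circ> h) (carrier L) (carrier N)"
    using h(2) k(2) by (rule bij_betw_trans)
  ultimately show ?thesis unfolding nearring_isomorphic_def by blast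
qed

text \<open>
  The additive group of the quotient is the quotient of the additive group, so theorems on
  factor groups apply to it.
\<close>

lemma add_monoid_Quot: "add_monoid (N Quot A) = add_monoid N Mod A"
  by (simp add: FactRing_def FactGroup_def A_RCOSETS_def set_add_def)

locale nearring_homomorphism = N: nearring N + B: nearring B
  for N (structure) and B (structure) +
  fixes f
  assumes homomorphism: "f \<in> nearring_hom N B"
begin

sublocale add: group_hom "add_monoid N" "add_monoid B" f
  using N.add_group B.add_group homomorphism
  by (simp add: nearring_hom_def group_hom_def group_hom_axioms_def)

lemma map_closed: "x \<in> carrier N \<Longrightarrow> f x \<in> carrier B"
  using add.hom_closed by simp

lemma map_add: "\<lbrakk>x \<in> carrier N; y \<in> carrier N\<rbrakk> \<Longrightarrow> f (x \<oplus> y) = f x \<oplus>\<^bsub>B\<^esub> f y"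
  using add.hom_mult by simp

lemma map_mult: "\<lbrakk>x \<in> carrier N; y \<in> carrier N\<rbrakk> \<Longrightarrow> f (x \<otimes> y) = f x \<otimes>\<^bsub>B\<^esub> f y"
  using homomorphism by (simp add: nearring_hom_def hom_def)

lemma minus_closed: "\<lbrakk>x \<in> carrier N; y \<in> carrier N\<rbrakk> \<Longrightarrow> x \<ominus> y \<in> carrier N"
  using add.G.m_closed[of x] add.G.inv_closed[of y] by (simp add: a_minus_def a_inv_def)

lemma map_minus_eq_zero:
  assumes "x \<in> carrier N" "y \<in> carrier N" "f x = f y"
  shows "f (x \<ominus> y) = \<zero>\<^bsub>B\<^esub>"
  using assms add.hom_mult[of x "inv\<^bsub>add_monoid N\<^esub> y"] add.hom_inv[of y]
    add.G.inv_closed[of y] add.H.r_inv[of "f y"] map_closed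
  by (simp add: a_minus_def a_inv_def)

lemma mem_kernel_iff: "x \<in> a_kernel N B f \<longleftrightarrow> x \<in> carrier N \<and> f x = \<zero>\<^bsub>B\<^esub>"
  by (simp add: a_kernel_def kernel_def)

lemma kernel_nearring_ideal: "nearring_ideal (a_kernel N B f) N"
  unfolding nearring_ideal_def
proof (intro conjI ballI)
  show "normal (a_kernel N B f) (add_monoid N)"
    unfolding a_kernel_def by (rule add.normal_kernel)
next
  fix i n assume "i \<in> a_kernel N B f" "n \<in> carrier N"
  then show "i \<otimes> n \<in> a_kernel N B f"
    by (simp add: mem_kernel_iff N.mult_closed map_mult map_closed B.zero_mult)
next
  fix i n m assume "i \<in> a_kernel N B f" and nm: "n \<in> carrier N" "m \<in> carrier N"
  then have i: "i \<in> carrier N" "f i = \<zero>\<^bsub>B\<^esub>"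
    by (simp_all add: mem_kernel_iff)
  have im: "i \<oplus> m \<in> carrier N"
    using add.G.m_closed i(1) nm(2) by simp
  have "f (i \<oplus> m) = f m"
    using i nm(2) add.H.l_one[of "f m"] by (simp add: map_add map_closed)
  then have "f (n \<otimes> (i \<oplus> m)) = f (n \<otimes> m)"
    using nm im by (simp add: map_mult)
  then show "n \<otimes> (i \<oplus> m) \<ominus> n \<otimes> m \<in> a_kernel N B f"
    using nm im by (simp add: mem_kernel_iff N.mult_closed minus_closed map_minus_eq_zero)
qed

lemma image_subnearring: "subnearring (f ` carrier N) B"
  unfolding subnearring_def
proof (intro conjI ballI)
  show "subgroup (f ` carrier N) (add_monoid B)"
    using add.img_is_subgroup by simp
next
  fix x y assume "x \<in> f ` carrier N" "y \<in> f ` carrier N"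
  then show "x \<otimes>\<^bsub>B\<^esub> y \<in> f ` carrier N"
    by (auto simp: N.mult_closed simp flip: map_mult)
qed

lemma isomorphic_image:
  assumes "inj_on f (carrier N)"
  shows "nearring_isomorphic N (B\<lparr>carrier := f ` carrier N\<rparr>)"
proof -
  have "f \<in> nearring_hom N (B\<lparr>carrier := f ` carrier N\<rparr>)"
    by (simp add: nearring_hom_def hom_def map_add map_mult)
  then show ?thesis
    using assms unfolding nearring_isomorphic_def by (auto simp: bij_betw_def)
qed

lemma kernel_coset_eq_fibre:
  assumes "x \<in> carrier N"
  shows "a_kernel N B f +> x = {y \<in> carrier N. f y = f x}"
proof (intro subset_antisym subsetI)
  fix y assume "y \<in> a_kernel N B f +> x"
  then obtain k where "k \<in> carrier N" "f k = \<zero>\<^bsub>B\<^esub>" "y = k \<oplus> x"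
    by (auto simp: a_r_coset_def' mem_kernel_iff)
  then show "y \<in> {y \<in> carrier N. f y = f x}"
    using assms add.G.m_closed add.H.l_one[of "f x"] by (simp add: map_add map_closed)
next
  fix y assume "y \<in> {y \<in> carrier N. f y = f x}"
  then have y: "y \<in> carrier N" "f y = f x" by simp_all
  have "y = (y \<ominus> x) \<oplus> x"
    using add.G.inv_solve_right[of "y \<ominus> x" y x] minus_closed[OF y(1) assms] y(1) assms
    unfolding a_minus_def a_inv_def by auto
  moreover have "y \<ominus> x \<in> a_kernel N B f"
    using y assms by (simp add: mem_kernel_iff minus_closed map_minus_eq_zero)
  ultimately show "y \<in> a_kernel N B f +> x"
    by (auto simp: a_r_coset_def')
qed

text \<open>
  The product of two cosets is by definition the union of the cosets of all products of
  representatives. All these cosets coincide, because \<open>f\<close> is constant on each factor.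
\<close>

lemma rcoset_mult_kernel:
  assumes x: "x \<in> carrier N" and y: "y \<in> carrier N"
  shows "rcoset_mult N (a_kernel N B f) (a_kernel N B f +> x) (a_kernel N B f +> y) =
    a_kernel N B f +> (x \<otimes> y)"
proof -
  have "a_kernel N B f +> (a \<otimes> b) = a_kernel N B f +> (x \<otimes> y)"
    if "a \<in> a_kernel N B f +> x" "b \<in> a_kernel N B f +> y" for a b
    using that x y by (simp add: kernel_coset_eq_fibre N.mult_closed map_mult)
  moreover have "x \<in> a_kernel N B f +> x" "y \<in> a_kernel N B f +> y"
    using x y by (simp_all add: kernel_coset_eq_fibre)
  ultimately show ?thesis
    unfolding rcoset_mult_def by blast
qed

text \<open>The first isomorphism theorem: the map \<open>N/ker f \<rightarrow> B\<close> sends a fibre to its value.\<close>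

lemma Quot_kernel_isomorphic:
  assumes "f ` carrier N = carrier B"
  shows "nearring_isomorphic (N Quot a_kernel N B f) B"
proof -
  let ?K = "a_kernel N B f" and ?h = "\<lambda>X. the_elem (f ` X)"
  have iso: "?h \<in> iso (add_monoid (N Quot ?K)) (add_monoid B)"
    unfolding add_monoid_Quot unfolding a_kernel_def
    using assms by (intro add.FactGroup_iso_set) simp
  have h: "?h (?K +> x) = f x" if "x \<in> carrier N" for x
  proof -
    have "f ` (?K +> x) = {f x}"
      using that by (auto simp: kernel_coset_eq_fibre)
    then show ?thesis by simp
  qed
  have "?h \<in> hom (N Quot ?K) B"
    by (auto simp: hom_def FactRing_def A_RCOSETS_def' rcoset_mult_kernel h N.mult_closed
        map_mult map_closed)
  then have "?h \<in> nearring_hom (N Quot ?K) B"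
    using iso by (simp add: nearring_hom_def iso_def)
  moreover have "bij_betw ?h (carrier (N Quot ?K)) (carrier B)"
    using iso by (simp add: iso_def)
  ultimately show ?thesis unfolding nearring_isomorphic_def by blast
qed

end

theorem proposition3p1:
  fixes N :: "('a, 'm) ring_scheme" and B :: "('b, 'n) ring_scheme"
    and f :: "'a \<Rightarrow> 'b" and A :: "'a set"
  assumes "nearring N" and "nearring B"
    and "nearring_split_epi N B f"
    and "a_kernel N B f = A"
  shows "\<exists>C. subnearring C N \<and> nearring_isomorphic B (N\<lparr>carrier := C\<rparr>) \<and> semidirect_sum N A C"
proof -
  obtain g where f_hom: "f \<in> nearring_hom N B" and g_hom: "g \<in> nearring_hom B N"
    and fg: "\<And>b. b \<in> carrier B \<Longrightarrow> f (g b) = b"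
    using assms(3) unfolding nearring_split_epi_def by blast
  interpret f: nearring_homomorphism N B f
    using assms(1,2) f_hom
    by (simp add: nearring_homomorphism_def nearring_homomorphism_axioms_def)
  interpret g: nearring_homomorphism B N g
    using assms(1,2) g_hom
    by (simp add: nearring_homomorphism_def nearring_homomorphism_axioms_def)
  let ?C = "g ` carrier B"
  have C: "subnearring ?C N" by (rule g.image_subnearring)
  have "inj_on g (carrier B)"
    using fg by (rule inj_on_inverseI)
  then have BC: "nearring_isomorphic B (N\<lparr>carrier := ?C\<rparr>)"
    by (rule g.isomorphic_image)
  have surj: "f ` carrier N = carrier B"
    using fg f.map_closed g.map_closed by force
  have sum: "carrier N = A <+>\<^bsub>N\<^esub> ?C"
  proof (intro subset_antisym subsetI)
    fix x assume x: "x \<in> carrier N"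
    define c where "c = g (f x)"
    have c: "c \<in> carrier N" "c \<in> ?C" "f x = f c"
      using x by (simp_all add: c_def f.map_closed g.map_closed fg)
    \<comment> \<open>\<open>x\<close> lies in the fibre of its own retract \<open>g (f x)\<close>, hence in the coset \<open>A + g (f x)\<close>.\<close>
    have "x \<in> A +>\<^bsub>N\<^esub> c"
      using x c f.kernel_coset_eq_fibre[OF c(1)] assms(4) by simp
    then show "x \<in> A <+>\<^bsub>N\<^esub> ?C"
      using c(2) unfolding a_r_coset_def' set_add_def' by blast
  next
    fix x assume "x \<in> A <+>\<^bsub>N\<^esub> ?C"
    then obtain a b where "a \<in> A" "b \<in> carrier B" "x = a \<oplus>\<^bsub>N\<^esub> g b"
      unfolding set_add_def' by blast
    then show "x \<in> carrier N"
      using assms(4) f.mem_kernel_iff f.add.G.m_closed g.map_closed by auto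
  qed
  have "g \<zero>\<^bsub>B\<^esub> = \<zero>\<^bsub>N\<^esub>" "f \<zero>\<^bsub>N\<^esub> = \<zero>\<^bsub>B\<^esub>" "\<zero>\<^bsub>B\<^esub> \<in> carrier B" "\<zero>\<^bsub>N\<^esub> \<in> carrier N"
    using g.add.hom_one f.add.hom_one f.add.H.one_closed f.add.G.one_closed by simp_all
  then have "A \<inter> ?C = {\<zero>\<^bsub>N\<^esub>}"
    using fg unfolding assms(4)[symmetric] by (force simp: f.mem_kernel_iff)
  moreover have "nearring_isomorphic (N Quot A) (N\<lparr>carrier := ?C\<rparr>)"
    using f.Quot_kernel_isomorphic[OF surj] BC unfolding assms(4)
    by (rule nearring_isomorphic_trans)
  moreover have "nearring_ideal A N"
    using f.kernel_nearring_ideal assms(4) by simp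
  ultimately have "semidirect_sum N A ?C"
    using assms(1) C sum unfolding semidirect_sum_def by blast
  with C BC show ?thesis by blast
qed

end
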